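(* Let $J(\delta)=\mathbb E\big[\sum_{k\ge 0}e^{-\theta k}g(X^\delta_k)-\sum_{\ell\ge 0}e^{-\theta(\tau_\ell+\Delta)}\Psi(\zeta_\ell)\big]$ for $\delta=(\tau_p,\zeta_p)_{p\ge0}\in\mathcal A$. For every $\varepsilon>0$ there exist an integer $n_\varepsilon\ge 1$ and a strategy $\delta_\varepsilon\in\mathcal A_{n_\varepsilon}$ such that $$\sup_{\delta\in\mathcal A}J(\delta)\le J(\delta_\varepsilon)+\varepsilon.$$
   Context: Setting: $(\Omega,\mathcal F,\mathbb P)$ is a probability space with a filtration $\mathbb F=(\mathcal F_n)_{n\ge 0}$. $\Delta\ge 1$ is an integer (the delay), $\theta>0$ is a constant, $\mathbb U$ is a nonempty finite subset of $\mathbb R^d$, $(X_n)_{n\ge 0}$ is an $\mathbb F$-adapted $\mathbb R^d$-valued process, $g:\mathbb R^d\to\mathbb R$ is bounded and Borel measurable, and $\Psi:\mathbb U\to\mathbb R$ is bounded. Stopping times are $\mathbb F$-stopping times with values in $\{0,1,2,\dots\}\cup\{+\infty\}$; $e^{-\theta\cdot\infty}=0$. Admissible strategies: $\mathcal A$ is the set of sequences $\delta=(\tau_p,\zeta_p)_{p\ge 0}$ such that each $\tau_p$ is a stopping time, $\tau_{p+1}\ge\tau_p+\Delta$ a.s., and $\zeta_p$ is a $\mathbb U$-valued $\mathcal F_{\tau_p}$-measurable random variable. For $n\ge 0$, $\mathcal A_n$ is the set of $\delta=(\tau_p,\zeta_p)_{p\ge 0}\in\mathcal A$ with $\tau_n=+\infty$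 a.s. (at most $n$ impulses). The controlled process is $$X^\delta_k=X_k1_{\{k<\tau_0+\Delta\}}+\sum_{\ell\ge 0}(X_k+\zeta_0+\cdots+\zeta_\ell)1_{\{\tau_\ell+\Delta\le k<\tau_{\ell+1}+\Delta\}},\quad k\ge 0.$$ *)

theory Defs
  imports "HOL-Probability.Probability"
begin

text \<open>
  Stopping times take values in \<^typ>\<open>enat\<close>, so the filtration is extended to the index
  \<open>\<infinity>\<close> by the \<open>\<sigma>\<close>-algebra generated by all the \<open>F n\<close>. At \<open>\<infinity>\<close> the library's
  \<^const>\<open>stopping_time\<close> imposes nothing further, and \<^const>\<open>filtration.pre_sigma\<close> becomes the
  usual \<open>\<sigma>\<close>-algebra of those \<open>A\<close> in \<open>F \<infinity>\<close> such that, for all \<open>n\<close>, the intersection of \<open>A\<close>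
  with \<open>{\<tau> \<le> n}\<close> is in \<open>F n\<close>.
\<close>

definition ext_filtration :: "'a set \<Rightarrow> (nat \<Rightarrow> 'a measure) \<Rightarrow> enat \<Rightarrow> 'a measure" where
  "ext_filtration \<Omega> F t = (case t of enat n \<Rightarrow> F n | \<infinity> \<Rightarrow> sigma \<Omega> (\<Union>n. sets (F n)))"

text \<open>A strategy \<open>\<delta>\<close> is the sequence of pairs \<open>\<delta> p = (\<tau>\<^sub>p, \<zeta>\<^sub>p)\<close>.\<close>

type_synonym ('a, 'v) strategy = "nat \<Rightarrow> ('a \<Rightarrow> enat) \<times> ('a \<Rightarrow> 'v)"

abbreviation imp_time :: "('a, 'v) strategy \<Rightarrow> nat \<Rightarrow> 'a \<Rightarrow> enat" where
  "imp_time \<delta> p \<equiv> fst (\<delta> p)"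

abbreviation imp_size :: "('a, 'v) strategy \<Rightarrow> nat \<Rightarrow> 'a \<Rightarrow> 'v" where
  "imp_size \<delta> p \<equiv> snd (\<delta> p)"

definition admissible ::
  "'a measure \<Rightarrow> (nat \<Rightarrow> 'a measure) \<Rightarrow> nat \<Rightarrow> (real^'d) set \<Rightarrow> ('a, real^'d) strategy set" where
  "admissible M F \<Delta> U = {\<delta>. \<forall>p.
     stopping_time (ext_filtration (space M) F) (imp_time \<delta> p) \<and>
     (AE \<omega> in M. imp_time \<delta> p \<omega> + enat \<Delta> \<le> imp_time \<delta> (Suc p) \<omega>) \<and>
     imp_size \<delta> p \<in> borel_measurable
       (filtration.pre_sigma (space M) (ext_filtration (space M) F) (imp_time \<delta> p)) \<and>
     (\<forall>\<omega>\<in>space M. imp_size \<delta> p \<omega> \<in> U)}"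

definition admissible_upto ::
  "'a measure \<Rightarrow> (nat \<Rightarrow> 'a measure) \<Rightarrow> nat \<Rightarrow> (real^'d) set \<Rightarrow> nat \<Rightarrow> ('a, real^'d) strategy set" where
  "admissible_upto M F \<Delta> U n = {\<delta> \<in> admissible M F \<Delta> U. AE \<omega> in M. imp_time \<delta> n \<omega> = \<infinity>}"

definition controlled ::
  "nat \<Rightarrow> (nat \<Rightarrow> 'a \<Rightarrow> real^'d) \<Rightarrow> ('a, real^'d) strategy \<Rightarrow> nat \<Rightarrow> 'a \<Rightarrow> real^'d" where
  "controlled \<Delta> X \<delta> k \<omega> =
     (if enat k < imp_time \<delta> 0 \<omega> + enat \<Delta> then X k \<omega> else 0) +
     (\<Sum>l. if imp_time \<delta> l \<omega> + enat \<Delta> \<le> enat k \<and> enat k < imp_time \<delta> (Suc l) \<omega> + enat \<Delta>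
           then X k \<omega> + (\<Sum>j\<le>l. imp_size \<delta> j \<omega>) else 0)"

definition discount :: "real \<Rightarrow> enat \<Rightarrow> real" where
  "discount \<theta> t = (case t of enat n \<Rightarrow> exp (- \<theta> * real n) | \<infinity> \<Rightarrow> 0)"

text \<open>
  For admissible \<open>\<delta>\<close>, \<open>\<theta> > 0\<close>, \<open>\<Delta> \<ge> 1\<close> and bounded \<open>g\<close>, \<open>\<Psi>\<close>, almost surely
  \<open>\<tau>\<^sub>l \<ge> l \<Delta>\<close>, so both series below converge absolutely almost surely and are essentially bounded.
\<close>

definition gain ::
  "'a measure \<Rightarrow> nat \<Rightarrow> real \<Rightarrow> (nat \<Rightarrow> 'a \<Rightarrow> real^'d) \<Rightarrow> (real^'d \<Rightarrow> real) \<Rightarrow> (real^'d \<Rightarrow> real) \<Rightarrow>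
   ('a, real^'d) strategy \<Rightarrow> real" where
  "gain M \<Delta> \<theta> X g \<Psi> \<delta> = (\<integral>\<omega>.
     ((\<Sum>k. exp (- \<theta> * real k) * g (controlled \<Delta> X \<delta> k \<omega>)) -
      (\<Sum>l. discount \<theta> (imp_time \<delta> l \<omega> + enat \<Delta>) * \<Psi> (imp_size \<delta> l \<omega>))) \<partial>M)"

end

theory Submission
  imports Defs
begin

text \<open>
  Since \<open>\<tau>\<^sub>l \<ge> l\<close> almost surely, discarding all impulses from the \<open>N\<close>-th one on leaves
  the controlled process unchanged up to time \<open>N\<close> and removes only costs discounted by at most
  \<open>exp (- \<theta> N)\<close>. With \<open>g\<close> and \<open>\<Psi>\<close> bounded by \<open>C\<close>, the gain therefore changes by at
  most \<open>3 C exp (- \<theta> N) / (1 - exp (- \<theta>))\<close>, uniformly in the strategy. Truncating a nearly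
  optimal strategy at a large enough \<open>N\<close> proves the claim.
\<close>

text \<open>The vanishing terms can be skipped, and the shifted series is dominated by a geometric
  one with first term \<open>C * r ^ N\<close>. With \<open>N = 0\<close> this bounds a whole payoff
  series, with larger \<open>N\<close> a truncation error.\<close>

lemma geometric_tail_bound:
  fixes h :: "nat \<Rightarrow> real"
  assumes r: "0 < r" "r < 1" and h: "\<And>k. \<bar>h k\<bar> \<le> C * r ^ k" and zero: "\<And>k. k < N \<Longrightarrow> h k = 0"
  shows "summable h" "\<bar>suminf h\<bar> \<le> C * r ^ N / (1 - r)"
proof -
  have geom: "(\<lambda>k. C * r ^ N * r ^ k) sums (C * r ^ N * (1 / (1 - r)))"
    using r by (intro sums_mult geometric_sums) simp
  show sm: "summable h"
  proof (rule summable_comparison_test'[of "\<lambda>k. C * r ^ k" 0])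
    show "summable (\<lambda>k. C * r ^ k)"
      using r by (intro summable_mult summable_geometric) simp
    show "norm (h k) \<le> C * r ^ k" for k
      using h[of k] by simp
  qed
  have shifted: "norm (h (k + N)) \<le> C * r ^ N * r ^ k" for k
    using h[of "k + N"] by (simp add: power_add mult_ac)
  have "suminf h = (\<Sum>k. h (k + N))"
    using suminf_split_initial_segment[OF sm, of N] zero by simp
  then show "\<bar>suminf h\<bar> \<le> C * r ^ N / (1 - r)"
    using norm_suminf_le[OF shifted sums_summable[OF geom]] sums_unique[OF geom] by simp
qed

section \<open>The filtration extended to infinity\<close>

lemma filtration_ext_filtration:
  assumes "filtration \<Omega> F"
  shows "filtration \<Omega> (ext_filtration \<Omega> F)"
proof -
  interpret filtration \<Omega> F by fact
  have sub: "(\<Union>n. sets (F n)) \<subseteq> Pow \<Omega>"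
    using sets.space_closed space_F by blast
  show ?thesis
  proof
    show "space (ext_filtration \<Omega> F i) = \<Omega>" for i
      using sub by (auto simp: ext_filtration_def space_F space_measure_of_conv split: enat.split)
    show "sets (ext_filtration \<Omega> F i) \<subseteq> sets (ext_filtration \<Omega> F j)" if "i \<le> j" for i j
      using that sets_F_mono sub
      by (cases i; cases j) (auto simp: ext_filtration_def sets_measure_of)
  qed
qed

text \<open>This transfers measurability from the filtration to \<open>M\<close>, also at
  \<open>\<infinity>\<close>, where the generators already lie in the \<sigma>-algebra
  \<open>sets M\<close>.\<close>

lemma sets_ext_filtration_subset:
  assumes "\<And>n. subalgebra M (F n)"
  shows "sets (ext_filtration (space M) F t) \<subseteq> sets M"
proof -
  have "sets (F n) \<subseteq> sets M" for n
    using assms by (auto simp: subalgebra_def)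
  then have gen: "(\<Union>n. sets (F n)) \<subseteq> sets M"
    by blast
  then have "(\<Union>n. sets (F n)) \<subseteq> Pow (space M)"
    using sets.space_closed by blast
  then show ?thesis
    using gen sets.sigma_sets_subset[OF gen]
    by (cases t) (simp_all add: ext_filtration_def UN_subset_iff)
qed

section \<open>Discounting and truncation of strategies\<close>

lemma discount_enat: "discount \<theta> (enat n) = exp (- \<theta>) ^ n"
  by (simp add: discount_def exp_of_nat_mult[symmetric] mult.commute)

lemma discount_nonneg: "0 \<le> discount \<theta> t"
  by (cases t) (auto simp: discount_def)

lemma discount_le:
  assumes "0 \<le> \<theta>" "enat n \<le> t"
  shows "discount \<theta> t \<le> exp (- \<theta>) ^ n"
  using assms by (cases t) (auto simp: discount_enat discount_def[of _ \<infinity>] power_decreasing)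

text \<open>The time \<open>\<infinity>\<close> cancels an impulse, since its discount factor is 0
  and it never takes effect. Its size must still lie in \<open>U\<close>, and \<open>u\<close>
  serves as that dummy value.\<close>

definition truncated :: "nat \<Rightarrow> 'v \<Rightarrow> ('a, 'v) strategy \<Rightarrow> ('a, 'v) strategy" where
  "truncated N u \<delta> p = (if p < N then \<delta> p else (\<lambda>_. \<infinity>, \<lambda>_. u))"

text \<open>An impulse of index at least \<open>N\<close> takes effect at time \<open>N\<close> or
  later, hence after \<open>k\<close>, so changing it is invisible at time \<open>k\<close>.\<close>

lemma controlled_truncated:
  assumes late: "\<And>l. enat l \<le> imp_time \<delta> l \<omega>" and k: "k < N"
  shows "controlled \<Delta> X (truncated N u \<delta>) k \<omega> = controlled \<Delta> X \<delta> k \<omega>"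
proof -
  have later: "\<not> imp_time \<delta> l \<omega> + enat \<Delta> \<le> enat k" if "N \<le> l" for l
    using late[of l] that k by (cases "imp_time \<delta> l \<omega>") auto
  have "(if imp_time (truncated N u \<delta>) l \<omega> + enat \<Delta> \<le> enat k \<and>
            enat k < imp_time (truncated N u \<delta>) (Suc l) \<omega> + enat \<Delta>
         then X k \<omega> + (\<Sum>j\<le>l. imp_size (truncated N u \<delta>) j \<omega>) else 0) =
        (if imp_time \<delta> l \<omega> + enat \<Delta> \<le> enat k \<and> enat k < imp_time \<delta> (Suc l) \<omega> + enat \<Delta>
         then X k \<omega> + (\<Sum>j\<le>l. imp_size \<delta> j \<omega>) else 0)" for l
  proof (cases "l < N")
    case True
    moreover have "(\<Sum>j\<le>l. imp_size (truncated N u \<delta>) j \<omega>) = (\<Sum>j\<le>l. imp_size \<delta> j \<omega>)"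
      using True by (intro sum.cong) (auto simp: truncated_def)
    \<comment> \<open>The boundary case \<open>l = N - 1\<close>: the right end of the interval is
      replaced by \<open>\<infinity>\<close>, but \<open>k\<close> lies below both the old and the
      new end.\<close>
    moreover have "enat k < imp_time \<delta> (Suc l) \<omega> + enat \<Delta>" if "\<not> Suc l < N"
      using later[of "Suc l"] that by simp
    ultimately show ?thesis
      by (cases "Suc l < N") (simp_all add: truncated_def)
  qed (use later in \<open>auto simp: truncated_def\<close>)
  \<comment> \<open>Here \<open>k < N\<close> forces \<open>N > 0\<close>, so the first impulse
    survives the truncation.\<close>
  moreover have "imp_time (truncated N u \<delta>) 0 = imp_time \<delta> 0"
    using k by (simp add: truncated_def)
  ultimately show ?thesis
    unfolding controlled_def by simp
qed

locale impulse_problem = prob_space M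
  for M :: "'a measure" +
  fixes F :: "nat \<Rightarrow> 'a measure" and \<Delta> :: nat and \<theta> :: real and U :: "(real^'d) set"
    and X :: "nat \<Rightarrow> 'a \<Rightarrow> real^'d" and g \<Psi> :: "real^'d \<Rightarrow> real" and C :: real
  assumes filtration: "filtration (space M) F" and subalgebra: "\<And>n. subalgebra M (F n)"
    and delay: "\<Delta> \<ge> 1" and rate: "\<theta> > 0" and finite_U: "finite U"
    and adapted: "\<And>n. X n \<in> borel_measurable (F n)"
    and g_measurable [measurable]: "g \<in> borel_measurable borel"
    and g_bound: "\<And>x. \<bar>g x\<bar> \<le> C" and \<Psi>_bound: "\<And>u. u \<in> U \<Longrightarrow> \<bar>\<Psi> u\<bar> \<le> C"
begin

abbreviation "payoff \<delta> \<omega> \<equiv>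
  (\<Sum>k. exp (- \<theta> * real k) * g (controlled \<Delta> X \<delta> k \<omega>)) -
  (\<Sum>l. discount \<theta> (imp_time \<delta> l \<omega> + enat \<Delta>) * \<Psi> (imp_size \<delta> l \<omega>))"

lemma C_nonneg: "0 \<le> C"
  using g_bound[of 0] by linarith

lemma ratio: "0 < exp (- \<theta>)" "exp (- \<theta>) < 1"
  using rate by auto

section \<open>Measurability of strategies and payoffs\<close>

lemma imp_time_measurable:
  assumes "\<delta> \<in> admissible M F \<Delta> U"
  shows "imp_time \<delta> p \<in> M \<rightarrow>\<^sub>M count_space UNIV"
proof -
  have "imp_time \<delta> p \<in> M \<rightarrow>\<^sub>M borel"
    using assms sets_ext_filtration_subset[of M F, OF subalgebra]
      filtration.space_F[OF filtration_ext_filtration[OF filtration]]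
    by (intro measurable_stopping_time[of "ext_filtration (space M) F"])
      (auto simp: admissible_def)
  then show ?thesis
    \<comment> \<open>As \<open>enat\<close> is countable, it suffices that preimages of singletons
      are measurable. With the discrete target, every function of an impulse time is measurable
      too.\<close>
    by (subst measurable_count_space_eq2_countable) (auto intro!: measurable_sets)
qed

lemma imp_size_measurable:
  assumes "\<delta> \<in> admissible M F \<Delta> U"
  shows "imp_size \<delta> p \<in> borel_measurable M"
proof -
  interpret E: filtration "space M" "ext_filtration (space M) F"
    by (rule filtration_ext_filtration[OF filtration])
  have st: "stopping_time (ext_filtration (space M) F) (imp_time \<delta> p)"
    and size: "imp_size \<delta> p \<in> borel_measurable (E.pre_sigma (imp_time \<delta> p))"
    using assms by (auto simp: admissible_def)
  have "sets (E.pre_sigma (imp_time \<delta> p)) \<subseteq> sets M"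
  proof
    fix A assume "A \<in> sets (E.pre_sigma (imp_time \<delta> p))"
    \<comment> \<open>At index \<open>\<infinity>\<close> the constraint \<tau> \<le> \<infinity>
      holds everywhere, so \<open>A\<close> itself lies in the extended filtration at
      \<open>\<infinity>\<close>.\<close>
    from E.sets_pre_sigmaD[OF st this, of \<infinity>]
    show "A \<in> sets M"
      using sets_ext_filtration_subset[of M F \<infinity>, OF subalgebra] by auto
  qed
  then show ?thesis
    using measurable_mono[OF order_refl refl _ E.space_pre_sigma] size by blast
qed

lemma X_measurable [measurable]: "X n \<in> borel_measurable M"
  using measurable_from_subalg[OF subalgebra adapted] .

text \<open>Since the size takes values in the finite set \<open>U\<close>, the composition is a
  finite combination of indicators of the events that the size equals \<open>u\<close>, whatever the
  function \<open>\<Psi>\<close>.\<close>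

lemma \<Psi>_size_measurable:
  assumes "\<delta> \<in> admissible M F \<Delta> U"
  shows "(\<lambda>\<omega>. \<Psi> (imp_size \<delta> p \<omega>)) \<in> borel_measurable M"
proof -
  have "(\<lambda>\<omega>. \<Sum>u\<in>U. if imp_size \<delta> p \<omega> = u then \<Psi> u else 0) \<in> borel_measurable M"
    using imp_size_measurable[OF assms, of p, measurable] by measurable
  moreover have "(\<Sum>u\<in>U. if imp_size \<delta> p \<omega> = u then \<Psi> u else 0) = \<Psi> (imp_size \<delta> p \<omega>)"
    if "\<omega> \<in> space M" for \<omega>
    using that assms finite_U by (subst sum.delta') (auto simp: admissible_def)
  ultimately show ?thesis
    by (simp cong: measurable_cong)
qed

lemma payoff_measurable:
  assumes "\<delta> \<in> admissible M F \<Delta> U"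
  shows "payoff \<delta> \<in> borel_measurable M"
proof -
  note [measurable] = imp_time_measurable[OF assms] imp_size_measurable[OF assms]
    \<Psi>_size_measurable[OF assms]
  have [measurable]: "controlled \<Delta> X \<delta> k \<in> borel_measurable M" for k
    unfolding controlled_def[abs_def] by measurable
  show ?thesis
    by measurable
qed

section \<open>Almost sure bounds\<close>

lemma imp_time_ge:
  assumes "\<delta> \<in> admissible M F \<Delta> U"
  shows "AE \<omega> in M. \<forall>l. enat l \<le> imp_time \<delta> l \<omega>"
proof -
  \<comment> \<open>Countably many almost sure gap conditions share one null set, so the induction
    can run for a fixed \<omega>.\<close>
  have "AE \<omega> in M. \<forall>p. imp_time \<delta> p \<omega> + enat \<Delta> \<le> imp_time \<delta> (Suc p) \<omega>"
    using assms by (auto simp: admissible_def AE_all_countable)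
  then show ?thesis
  proof eventually_elim
    case (elim \<omega>)
    show ?case
    proof
      show "enat l \<le> imp_time \<delta> l \<omega>" for l
      proof (induction l)
        case (Suc l)
        have "enat (Suc l) \<le> enat l + enat \<Delta>"
          using delay by simp
        also have "\<dots> \<le> imp_time \<delta> l \<omega> + enat \<Delta>"
          by (intro add_right_mono Suc)
        finally show ?case
          using elim order_trans by blast
      qed (simp add: zero_enat_def[symmetric])
    qed
  qed
qed

lemma running_bound: "\<bar>exp (- \<theta> * real k) * g x\<bar> \<le> C * exp (- \<theta>) ^ k"
  using g_bound[of x]
  by (simp add: abs_mult exp_of_nat_mult[symmetric] mult.commute mult_right_mono)

lemma cost_bound:
  assumes "enat l \<le> t" "u \<in> U"
  shows "\<bar>discount \<theta> (t + enat \<Delta>) * \<Psi> u\<bar> \<le> C * exp (- \<theta>) ^ l"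
proof -
  have "enat l \<le> t + enat \<Delta>"
    using assms(1) by (cases t) auto
  then have "discount \<theta> (t + enat \<Delta>) * \<bar>\<Psi> u\<bar> \<le> exp (- \<theta>) ^ l * C"
    using rate assms(2)
    by (intro mult_mono discount_le \<Psi>_bound) auto
  then show ?thesis
    by (simp add: abs_mult discount_nonneg mult.commute)
qed

lemma payoff_bound:
  assumes "\<delta> \<in> admissible M F \<Delta> U"
  shows "AE \<omega> in M. \<bar>payoff \<delta> \<omega>\<bar> \<le> 2 * C / (1 - exp (- \<theta>))"
  using imp_time_ge[OF assms] AE_space
proof eventually_elim
  case (elim \<omega>)
  have size: "imp_size \<delta> l \<omega> \<in> U" for l
    using assms elim(2) by (auto simp: admissible_def)
  \<comment> \<open>The factor with exponent 0 matches the tail bound at \<open>N = 0\<close>, where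
    the vanishing condition is empty.\<close>
  have "\<bar>\<Sum>k. exp (- \<theta> * real k) * g (controlled \<Delta> X \<delta> k \<omega>)\<bar> \<le> C * exp (- \<theta>) ^ 0 / (1 - exp (- \<theta>))"
    by (rule geometric_tail_bound(2)[OF ratio running_bound]) simp
  moreover have "\<bar>\<Sum>l. discount \<theta> (imp_time \<delta> l \<omega> + enat \<Delta>) * \<Psi> (imp_size \<delta> l \<omega>)\<bar>
      \<le> C * exp (- \<theta>) ^ 0 / (1 - exp (- \<theta>))"
    using elim(1) size by (intro geometric_tail_bound(2)[OF ratio cost_bound]) auto
  ultimately show ?case
    by simp
qed

section \<open>Pathwise truncation error\<close>

lemma truncated_admissible:
  assumes "\<delta> \<in> admissible M F \<Delta> U" "u \<in> U"
  shows "truncated N u \<delta> \<in> admissible_upto M F \<Delta> U N"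
  \<comment> \<open>At and after the cut the gap condition holds because the next time is
    \<open>\<infinity>\<close>, the top element.\<close>
  using assms by (auto simp: admissible_upto_def admissible_def truncated_def stopping_time_const)

lemma payoff_truncated:
  assumes adm: "\<delta> \<in> admissible M F \<Delta> U" and u: "u \<in> U"
  shows "AE \<omega> in M. \<bar>payoff \<delta> \<omega> - payoff (truncated N u \<delta>) \<omega>\<bar>
    \<le> 3 * C * exp (- \<theta>) ^ N / (1 - exp (- \<theta>))"
  using imp_time_ge[OF adm] AE_space
proof eventually_elim
  case (elim \<omega>)
  let ?r = "exp (- \<theta>)" and ?\<delta>' = "truncated N u \<delta>"
  define a where "a \<eta> k = exp (- \<theta> * real k) * g (controlled \<Delta> X \<eta> k \<omega>)" for \<eta> k
  define b where "b \<eta> l = discount \<theta> (imp_time \<eta> l \<omega> + enat \<Delta>) * \<Psi> (imp_size \<eta> l \<omega>)" for \<eta> l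
  have size: "imp_size \<delta> l \<omega> \<in> U" for l
    using adm elim(2) by (auto simp: admissible_def)
  have a_bound: "\<bar>a \<eta> k\<bar> \<le> C * ?r ^ k" for \<eta> k
    unfolding a_def by (rule running_bound)
  have b_bound: "\<bar>b \<delta> l\<bar> \<le> C * ?r ^ l" for l
    unfolding b_def using elim(1) size by (intro cost_bound) auto
  have b': "b ?\<delta>' l = (if l < N then b \<delta> l else 0)" for l
    by (simp add: b_def truncated_def discount_def)
  have b'_bound: "\<bar>b ?\<delta>' l\<bar> \<le> C * ?r ^ l" for l
    using b_bound[of l] C_nonneg by (simp add: b')
  note summables = geometric_tail_bound(1)[OF ratio a_bound, of 0]
    geometric_tail_bound(1)[OF ratio b_bound, of 0] geometric_tail_bound(1)[OF ratio b'_bound, of 0]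
  \<comment> \<open>Running rewards agree before \<open>N\<close>; from then on nothing relates the
    two controlled processes, so each reward is bounded separately, which gives the factor
    2.\<close>
  have "\<bar>\<Sum>k. a \<delta> k - a ?\<delta>' k\<bar> \<le> (2 * C) * ?r ^ N / (1 - ?r)"
  proof (rule geometric_tail_bound(2)[OF ratio])
    show "\<bar>a \<delta> k - a ?\<delta>' k\<bar> \<le> 2 * C * ?r ^ k" for k
      using a_bound[of \<delta> k] a_bound[of ?\<delta>' k] by linarith
    show "a \<delta> k - a ?\<delta>' k = 0" if "k < N" for k
      using controlled_truncated[of \<delta> \<omega> k N] elim(1) that by (simp add: a_def)
  qed
  \<comment> \<open>Costs differ only by the discarded terms, so a single \<open>C\<close> suffices
    here; together with the rewards this makes \<open>3 * C\<close>.\<close>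
  moreover have "\<bar>\<Sum>l. b \<delta> l - b ?\<delta>' l\<bar> \<le> C * ?r ^ N / (1 - ?r)"
    using b_bound C_nonneg by (intro geometric_tail_bound(2)[OF ratio]) (auto simp: b')
  moreover have "(\<Sum>k. a \<delta> k - a ?\<delta>' k) = suminf (a \<delta>) - suminf (a ?\<delta>')"
    "(\<Sum>l. b \<delta> l - b ?\<delta>' l) = suminf (b \<delta>) - suminf (b ?\<delta>')"
    using summables by (simp_all add: suminf_diff)
  ultimately have "\<bar>(suminf (a \<delta>) - suminf (b \<delta>)) - (suminf (a ?\<delta>') - suminf (b ?\<delta>'))\<bar>
      \<le> 2 * C * ?r ^ N / (1 - ?r) + C * ?r ^ N / (1 - ?r)"
    by linarith
  also have "\<dots> = 3 * C * ?r ^ N / (1 - ?r)"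
    by (simp add: add_divide_distrib[symmetric])
  finally show ?case
    unfolding a_def b_def .
qed

section \<open>Expected gains and the choice of the strategy\<close>

lemma payoff_integrable:
  assumes "\<delta> \<in> admissible M F \<Delta> U"
  shows "integrable M (payoff \<delta>)"
  using payoff_bound[OF assms] payoff_measurable[OF assms]
  by (intro integrable_const_bound) auto

text \<open>The bound is the same for all strategies, so the supremum of the gains is finite and can
  be approached within any positive margin.\<close>

lemma gain_le:
  assumes "\<delta> \<in> admissible M F \<Delta> U"
  shows "gain M \<Delta> \<theta> X g \<Psi> \<delta> \<le> 2 * C / (1 - exp (- \<theta>))"
  unfolding gain_def using payoff_bound[OF assms]
  by (intro integral_le_const payoff_integrable[OF assms]) auto

lemma gain_truncated:
  assumes adm: "\<delta> \<in> admissible M F \<Delta> U" and u: "u \<in> U"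
  shows "gain M \<Delta> \<theta> X g \<Psi> \<delta>
    \<le> gain M \<Delta> \<theta> X g \<Psi> (truncated N u \<delta>) + 3 * C * exp (- \<theta>) ^ N / (1 - exp (- \<theta>))"
proof -
  have adm': "truncated N u \<delta> \<in> admissible M F \<Delta> U"
    using truncated_admissible[OF assms] by (simp add: admissible_upto_def)
  note int = payoff_integrable[OF adm] payoff_integrable[OF adm']
  have "gain M \<Delta> \<theta> X g \<Psi> \<delta> - gain M \<Delta> \<theta> X g \<Psi> (truncated N u \<delta>) =
      (\<integral>\<omega>. payoff \<delta> \<omega> - payoff (truncated N u \<delta>) \<omega> \<partial>M)"
    unfolding gain_def by (rule Bochner_Integration.integral_diff[OF int, symmetric])
  also have "\<dots> \<le> 3 * C * exp (- \<theta>) ^ N / (1 - exp (- \<theta>))"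
  proof (rule integral_le_const[OF Bochner_Integration.integrable_diff[OF int]])
    show "AE \<omega> in M. payoff \<delta> \<omega> - payoff (truncated N u \<delta>) \<omega>
        \<le> 3 * C * exp (- \<theta>) ^ N / (1 - exp (- \<theta>))"
      using payoff_truncated[OF assms, of N] by eventually_elim linarith
  qed
  finally show ?thesis
    by linarith
qed

text \<open>Never intervening shows that there is some admissible strategy, as the extraction of a
  nearly optimal one requires.\<close>

lemma never_admissible:
  assumes "u \<in> U"
  shows "(\<lambda>_. (\<lambda>_. \<infinity>, \<lambda>_. u)) \<in> admissible M F \<Delta> U"
  using assms by (simp add: admissible_def stopping_time_const)

lemma finitely_many_impulses_suffice:
  assumes u: "u \<in> U" and \<epsilon>: "\<epsilon> > 0"
  shows "\<exists>n\<ge>1. \<exists>\<delta>'\<in>admissible_upto M F \<Delta> U n.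
    \<forall>\<delta>\<in>admissible M F \<Delta> U. gain M \<Delta> \<theta> X g \<Psi> \<delta> \<le> gain M \<Delta> \<theta> X g \<Psi> \<delta>' + \<epsilon>"
proof -
  let ?J = "gain M \<Delta> \<theta> X g \<Psi>" and ?A = "admissible M F \<Delta> U"
  have bdd: "bdd_above (?J ` ?A)"
    using gain_le by (intro bdd_aboveI2)
  \<comment> \<open>Half of \<open>\<epsilon>\<close> pays for taking a nearly optimal strategy, the
    other half for truncating it.\<close>
  have "(SUP \<delta>\<in>?A. ?J \<delta>) - \<epsilon> / 2 < (SUP \<delta>\<in>?A. ?J \<delta>)"
    using \<epsilon> by simp
  then obtain \<delta> where \<delta>: "\<delta> \<in> ?A" "(SUP \<delta>\<in>?A. ?J \<delta>) - \<epsilon> / 2 < ?J \<delta>"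
    using never_admissible[OF u] bdd by (subst (asm) less_cSUP_iff) auto
  have "(\<lambda>N. 3 * C * exp (- \<theta>) ^ N / (1 - exp (- \<theta>))) \<longlonglongrightarrow> 3 * C * 0 / (1 - exp (- \<theta>))"
    using ratio by (intro tendsto_intros LIMSEQ_realpow_zero) auto
  then have "eventually (\<lambda>N. 3 * C * exp (- \<theta>) ^ N / (1 - exp (- \<theta>)) < \<epsilon> / 2) sequentially"
    using \<epsilon> by (intro order_tendstoD) auto
  with eventually_ge_at_top[of 1]
  have "eventually (\<lambda>N. 1 \<le> N \<and> 3 * C * exp (- \<theta>) ^ N / (1 - exp (- \<theta>)) < \<epsilon> / 2) sequentially"
    by (rule eventually_conj)
  then obtain N where N: "1 \<le> N" "3 * C * exp (- \<theta>) ^ N / (1 - exp (- \<theta>)) < \<epsilon> / 2"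
    using eventually_happens' sequentially_bot by blast
  \<comment> \<open>An arbitrary \<open>\<eta>\<close> is compared with the supremum, then with the
    nearly optimal \<open>\<delta>\<close>, then with its truncation.\<close>
  have "?J \<eta> \<le> ?J (truncated N u \<delta>) + \<epsilon>" if "\<eta> \<in> ?A" for \<eta>
    using cSUP_upper[OF that bdd] \<delta>(2) gain_truncated[OF \<delta>(1) u, of N] N(2) by linarith
  with truncated_admissible[OF \<delta>(1) u] N(1) show ?thesis
    by blast
qed

end

theorem proposition3p11:
  fixes M :: "'a measure" and F :: "nat \<Rightarrow> 'a measure"
    and \<Delta> :: nat and \<theta> :: real and U :: "(real^'d) set"
    and X :: "nat \<Rightarrow> 'a \<Rightarrow> real^'d" and g \<Psi> :: "real^'d \<Rightarrow> real"
  assumes "prob_space M"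
    and "filtration (space M) F" and "\<And>n. subalgebra M (F n)"
    and "\<Delta> \<ge> 1" and "\<theta> > 0"
    and "finite U" and "U \<noteq> {}"
    and "\<And>n. X n \<in> borel_measurable (F n)"
    and "g \<in> borel_measurable borel" and "bounded (range g)"
    and "bounded (\<Psi> ` U)"
  shows "\<forall>\<epsilon>>0. \<exists>n\<ge>1. \<exists>\<delta>\<^sub>\<epsilon>\<in>admissible_upto M F \<Delta> U n.
    (SUP \<delta>\<in>admissible M F \<Delta> U. ereal (gain M \<Delta> \<theta> X g \<Psi> \<delta>))
      \<le> ereal (gain M \<Delta> \<theta> X g \<Psi> \<delta>\<^sub>\<epsilon> + \<epsilon>)"
proof (intro allI impI)
  fix \<epsilon> :: real assume \<epsilon>: "\<epsilon> > 0"
  obtain a b where a: "\<And>x. \<bar>g x\<bar> \<le> a" and b: "\<And>u. u \<in> U \<Longrightarrow> \<bar>\<Psi> u\<bar> \<le> b"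
    using assms(10,11) by (auto simp: bounded_iff)
  \<comment> \<open>The locale has one constant for both functions, so the larger of the two bounds
    is taken.\<close>
  interpret impulse_problem M F \<Delta> \<theta> U X g \<Psi> "max a b"
  proof (intro impulse_problem.intro impulse_problem_axioms.intro)
    show "\<bar>g x\<bar> \<le> max a b" for x
      using a[of x] by simp
    show "\<bar>\<Psi> u\<bar> \<le> max a b" if "u \<in> U" for u
      using b[OF that] by simp
  qed (use assms in auto)
  from \<open>U \<noteq> {}\<close> obtain u where "u \<in> U"
    by blast
  from finitely_many_impulses_suffice[OF this \<epsilon>]
  show "\<exists>n\<ge>1. \<exists>\<delta>\<^sub>\<epsilon>\<in>admissible_upto M F \<Delta> U n.
      (SUP \<delta>\<in>admissible M F \<Delta> U. ereal (gain M \<Delta> \<theta> X g \<Psi> \<delta>))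
        \<le> ereal (gain M \<Delta> \<theta> X g \<Psi> \<delta>\<^sub>\<epsilon> + \<epsilon>)"
    \<comment> \<open>In the complete lattice \<open>ereal\<close>, a bound for every single
      strategy is the same as a bound for the supremum.\<close>
    by (auto simp: SUP_le_iff)
qed

end
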